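(* Let $0\le\eta<1$ be real and let $$\tau=(1-\eta)\sin\left(\frac{\pi}{4}-\arctan\eta\right)>0.$$ Let $n$ be a positive integer and let $Z=(z_{ij})$ be an $n\times n$ complex matrix such that $$\left|1-\Re z_{ij}\right|\le\eta\quad\text{and}\quad\left|\Im z_{ij}\right|\le\tau\quad\text{for all }1\le i,j\le n.$$ Then $\operatorname{per}Z\ne 0$.
   Context: The permanent of an $n\times n$ matrix $Z=(z_{ij})$ is $\operatorname{per}Z=\sum_{\sigma\in S_n}\prod_{i=1}^n z_{i\sigma(i)}$, where $S_n$ is the symmetric group of permutations of $\{1,\dots,n\}$. $\Re z$ and $\Im z$ denote the real and imaginary parts of $z$; $\arctan$ takes values in $(-\pi/2,\pi/2)$. *)

theory Defs
  imports "HOL-Analysis.Analysis"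
begin

definition permanent :: "'a::comm_ring_1 ^ 'n ^ 'n \<Rightarrow> 'a" where
  "permanent A = (\<Sum>p | p permutes (UNIV :: 'n set). \<Prod>i\<in>UNIV. A $ i $ p i)"

end

theory Submission
  imports Defs
begin

text \<open>
  The idea is to prove, by induction on the size, more than non-vanishing: if two square
  submatrices of a matrix whose entries satisfy the two bounds differ in a single row (or a single column), then their
  permanents are non-zero and the angle between them, as vectors in the plane, is at most
  \<open>\<pi> / 2\<close>.

  Expanding both permanents along the row in which they differ writes them as combinations
  \<open>v = \<Sum> a\<^sub>c u\<^sub>c\<close> and \<open>w = \<Sum> b\<^sub>c u\<^sub>c\<close> of the same smaller permanents \<open>u\<^sub>c\<close>. Any two of the \<open>u\<^sub>c\<close>
  are permanents of submatrices that differ in a single column, so by the induction hypothesis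
  (applied to the transpose) the \<open>u\<^sub>c\<close> are non-zero and pairwise at angle at most \<open>\<pi> / 2\<close>. What
  remains is a statement about plane vectors, \<open>admissible_combinations\<close>: the angle between \<open>v\<close> and
  \<open>w\<close> is again at most \<open>\<pi> / 2\<close>.

  To see this, let \<open>v'\<close> and \<open>w'\<close> be the combinations with the real parts of the coefficients. Since
  all inner products of the \<open>u\<^sub>c\<close> are non-negative, a reverse Cauchy-Schwarz inequality
  (\<open>reverse_Cauchy_Schwarz_comb\<close>) bounds the angle between \<open>v'\<close> and \<open>w'\<close> by \<open>2 arctan \<eta>\<close>. For the same
  reason the imaginary parts contribute to \<open>v\<close> a vector of length at most
  \<open>\<tau> / (1 - \<eta>) = sin (\<pi> / 4 - arctan \<eta>)\<close> times the length of \<open>v'\<close>, so that they turn \<open>v'\<close> by at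
  most \<open>\<pi> / 4 - arctan \<eta>\<close>; likewise for \<open>w\<close>. The three angles add up to exactly \<open>\<pi> / 2\<close>, which
  explains the value of \<open>\<tau>\<close>.
\<close>

section \<open>Combinations of vectors at pairwise non-obtuse angles\<close>

lemma inner_comb_expand:
  fixes u :: "'i \<Rightarrow> 'v::real_inner"
  shows "(\<Sum>i\<in>I. a i *\<^sub>R u i) \<bullet> (\<Sum>i\<in>I. b i *\<^sub>R u i)
           = (\<Sum>i\<in>I. \<Sum>j\<in>I. (a i * b j) * (u i \<bullet> u j))"
  unfolding inner_sum_left unfolding inner_sum_right
  by (simp add: mult.assoc mult.left_commute)

lemma norm_comb_mono:
  fixes u :: "'i \<Rightarrow> 'v::real_inner"
  assumes "\<And>i j. i \<in> I \<Longrightarrow> j \<in> I \<Longrightarrow> u i \<bullet> u j \<ge> 0"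
    and "\<And>i. i \<in> I \<Longrightarrow> \<bar>a i\<bar> \<le> b i"
  shows "norm (\<Sum>i\<in>I. a i *\<^sub>R u i) \<le> norm (\<Sum>i\<in>I. b i *\<^sub>R u i)"
proof -
  have "a i * a j \<le> b i * b j" if "i \<in> I" "j \<in> I" for i j
  proof -
    have "\<bar>a i\<bar> * \<bar>a j\<bar> \<le> b i * b j"
      using assms(2)[OF that(1)] assms(2)[OF that(2)] by (intro mult_mono) auto
    then show ?thesis
      by (metis abs_le_D1 abs_mult)
  qed
  then have "(\<Sum>i\<in>I. a i *\<^sub>R u i) \<bullet> (\<Sum>i\<in>I. a i *\<^sub>R u i) \<le> (\<Sum>i\<in>I. b i *\<^sub>R u i) \<bullet> (\<Sum>i\<in>I. b i *\<^sub>R u i)"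
    unfolding inner_comb_expand by (intro sum_mono mult_right_mono assms(1))
  then show ?thesis
    by (simp add: norm_le)
qed

text \<open>
  The classical argument for scalars: \<open>a\<^sub>i - m b\<^sub>i\<close> and \<open>M b\<^sub>j - a\<^sub>j\<close> are non-negative, hence so is the
  inner product of \<open>v - m w\<close> and \<open>M w - v\<close>, and the bound follows from
  \<open>\<bar>v\<bar>\<^sup>2 + m M \<bar>w\<bar>\<^sup>2 \<ge> 2 \<surd>(m M) \<bar>v\<bar> \<bar>w\<bar>\<close>. Here \<open>M = 1 / m = (1 + \<eta>) / (1 - \<eta>)\<close>, cleared of
  denominators.
\<close>
lemma reverse_Cauchy_Schwarz_comb:
  fixes u :: "'i \<Rightarrow> 'v::real_inner"
  assumes \<eta>: "0 \<le> \<eta>" "\<eta> < 1"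
    and G: "\<And>i j. i \<in> I \<Longrightarrow> j \<in> I \<Longrightarrow> u i \<bullet> u j \<ge> 0"
    and a: "\<And>i. i \<in> I \<Longrightarrow> \<bar>1 - a i\<bar> \<le> \<eta>"
    and b: "\<And>i. i \<in> I \<Longrightarrow> \<bar>1 - b i\<bar> \<le> \<eta>"
  defines "v \<equiv> \<Sum>i\<in>I. a i *\<^sub>R u i" and "w \<equiv> \<Sum>i\<in>I. b i *\<^sub>R u i"
  shows "(1 - \<eta>\<^sup>2) * (norm v * norm w) \<le> (1 + \<eta>\<^sup>2) * (v \<bullet> w)"
proof -
  define p q where "p = 1 + \<eta>" and "q = 1 - \<eta>"
  have pq: "p > 0" "q > 0"
    using \<eta> by (auto simp: p_def q_def)
  have lower: "0 \<le> p * a i - q * b i" and upper: "0 \<le> p * b i - q * a i" if "i \<in> I" for i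
  proof -
    have ab: "q \<le> a i" "a i \<le> p" "q \<le> b i" "b i \<le> p"
      using a[OF that] b[OF that] by (auto simp: p_def q_def)
    show "0 \<le> p * a i - q * b i" "0 \<le> p * b i - q * a i"
      using mult_mono[of q "a i" "b i" p] mult_mono[of q "b i" "a i" p] ab pq
      by (auto simp: mult.commute)
  qed
  have comb: "(\<Sum>i\<in>I. (p * a i - q * b i) *\<^sub>R u i) = p *\<^sub>R v - q *\<^sub>R w"
    "(\<Sum>i\<in>I. (p * b i - q * a i) *\<^sub>R u i) = p *\<^sub>R w - q *\<^sub>R v"
    by (simp_all add: v_def w_def scaleR_diff_left sum_subtractf scaleR_sum_right)
  have "0 \<le> (p *\<^sub>R v - q *\<^sub>R w) \<bullet> (p *\<^sub>R w - q *\<^sub>R v)"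
    unfolding comb[symmetric] inner_comb_expand
    by (intro sum_nonneg mult_nonneg_nonneg lower upper G)
  also have "\<dots> = (p\<^sup>2 + q\<^sup>2) * (v \<bullet> w) - p * q * ((norm v)\<^sup>2 + (norm w)\<^sup>2)"
    unfolding power2_norm_eq_inner
    by (simp add: inner_diff_left inner_diff_right inner_commute[of w v]
        algebra_simps power2_eq_square)
  also have "\<dots> \<le> (p\<^sup>2 + q\<^sup>2) * (v \<bullet> w) - p * q * (2 * (norm v * norm w))"
    using sum_squares_bound[of "norm v" "norm w"] pq
    by (intro diff_left_mono mult_left_mono) (auto simp: mult.assoc)
  finally show ?thesis
    by (simp add: p_def q_def power2_eq_square algebra_simps)
qed

section \<open>Adding up angles in the complex plane\<close>

text \<open>
  The hypothesis \<open>cos \<alpha> * norm x \<le> Re x\<close> says that \<open>x\<close> makes an angle of at most \<open>\<alpha>\<close> with the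
  positive real axis; in this form it makes sense for \<open>x = 0\<close> too and needs no choice of argument.
\<close>
lemma angle_mult:
  fixes x y :: complex
  assumes x: "cos \<alpha> * norm x \<le> Re x" and y: "cos \<beta> * norm y \<le> Re y"
    and pos: "0 \<le> \<alpha>" "0 \<le> \<beta>" and le: "\<alpha> + \<beta> \<le> pi"
  shows "cos (\<alpha> + \<beta>) * norm (x * y) \<le> Re (x * y)"
proof (cases "x = 0 \<or> y = 0")
  case False
  have Arg_le: "\<bar>Arg z\<bar> \<le> \<gamma>" if "cos \<gamma> * norm z \<le> Re z" "z \<noteq> 0" "0 \<le> \<gamma>" "\<gamma> \<le> pi" for z \<gamma>
  proof -
    have "cos \<gamma> * norm z \<le> cos \<bar>Arg z\<bar> * norm z"
      using that(1,2) by (simp add: cos_Arg)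
    then have "cos \<gamma> \<le> cos \<bar>Arg z\<bar>"
      using that(2) by simp
    then show ?thesis
      using that(3,4) mpi_less_Arg[of z] Arg_le_pi[of z] cos_mono_le_eq[of \<gamma> "\<bar>Arg z\<bar>"] by auto
  qed
  have "\<bar>Arg x\<bar> \<le> \<alpha>" "\<bar>Arg y\<bar> \<le> \<beta>"
    using False x y pos le by (auto intro!: Arg_le)
  then have "\<bar>Arg x + Arg y\<bar> \<le> \<alpha> + \<beta>"
    by linarith
  then have "cos (\<alpha> + \<beta>) \<le> cos \<bar>Arg x + Arg y\<bar>"
    using le by (intro cos_monotone_0_pi_le) auto
  then have "cos (\<alpha> + \<beta>) \<le> cos (Arg x + Arg y)"
    by simp
  then have "cos (\<alpha> + \<beta>) * (norm x * norm y) \<le> cos (Arg x + Arg y) * (norm x * norm y)"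
    by (intro mult_right_mono) auto
  also have "\<dots> = Re (x * y)"
    using False by (simp add: cos_add cos_Arg sin_Arg field_simps)
  finally show ?thesis
    by (simp add: norm_mult)
qed auto

text \<open>The disc of radius \<open>sin \<theta>\<close> about \<open>1\<close> is seen from the origin under the half-angle \<open>\<theta>\<close>.\<close>
lemma angle_perturb:
  fixes e :: complex
  assumes e: "norm e \<le> sin \<theta>" and \<theta>: "0 < \<theta>" "\<theta> < pi / 2"
  shows "cos \<theta> * norm (1 + e) \<le> Re (1 + e)" and "1 + e \<noteq> 0"
proof -
  define x y c where "x = Re (1 + e)" and "y = Im (1 + e)" and "c = (cos \<theta>)\<^sup>2"
  have "sin \<theta> < 1"
    using \<theta> sin_monotone_2pi[of \<theta> "pi / 2"] by simp
  then have xpos: "x > 0"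
    using e abs_Re_le_cmod[of e] by (auto simp: x_def)
  then show "1 + e \<noteq> 0"
    unfolding x_def by (metis less_irrefl zero_complex.sel(1))
  have "(norm e)\<^sup>2 \<le> (sin \<theta>)\<^sup>2"
    using e by (intro power_mono) auto
  then have disc: "(x - 1)\<^sup>2 + y\<^sup>2 \<le> 1 - c"
    by (simp add: cmod_power2 x_def y_def c_def sin_squared_eq)
  have "c * ((x - 1)\<^sup>2 + y\<^sup>2) \<le> c * (1 - c)"
    using disc by (intro mult_left_mono) (auto simp: c_def)
  \<comment> \<open>The slack vanishes at the points of tangency, where \<open>x = c\<close>.\<close>
  moreover have "x\<^sup>2 - c * (x\<^sup>2 + y\<^sup>2) = (x - c)\<^sup>2 + (c * (1 - c) - c * ((x - 1)\<^sup>2 + y\<^sup>2))"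
    by (simp add: power2_eq_square algebra_simps)
  ultimately have "c * (x\<^sup>2 + y\<^sup>2) \<le> x\<^sup>2"
    using zero_le_power2[of "x - c"] by linarith
  then have "(cos \<theta> * norm (1 + e))\<^sup>2 \<le> x\<^sup>2"
    unfolding power_mult_distrib cmod_power2 x_def y_def c_def .
  then show "cos \<theta> * norm (1 + e) \<le> Re (1 + e)"
    using xpos by (auto simp: x_def intro: power2_le_imp_le)
qed

lemma cos_double_arctan: "cos (2 * arctan x) = (1 - x\<^sup>2) / (1 + x\<^sup>2)"
proof -
  have "1 + x\<^sup>2 > 0"
    by (simp add: add_pos_nonneg)
  then show ?thesis
    by (simp add: cos_double cos_arctan sin_arctan power_divide diff_divide_distrib)
qed

section \<open>Combinations with admissible coefficients\<close>

lemma arctan_less_pi_4: "arctan x < pi / 4" if "x < 1"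
  using arctan_less_iff[of x 1] that by (simp add: arctan_one)

text \<open>
  The induction step for permanents, as a statement about plane vectors; \<open>inner\<close> is the real inner
  product on the complex numbers, so that the last conclusion bounds the angle by \<open>\<pi> / 2\<close>.
\<close>
lemma admissible_combinations:
  fixes u a b :: "'i \<Rightarrow> complex"
  assumes \<eta>: "0 \<le> \<eta>" "\<eta> < 1" and \<tau>: "\<tau> = (1 - \<eta>) * sin (pi / 4 - arctan \<eta>)"
    and I: "finite I" "I \<noteq> {}"
    and u: "\<And>i. i \<in> I \<Longrightarrow> u i \<noteq> 0"
    and G: "\<And>i j. i \<in> I \<Longrightarrow> j \<in> I \<Longrightarrow> u i \<bullet> u j \<ge> 0"
    and a: "\<And>i. i \<in> I \<Longrightarrow> \<bar>1 - Re (a i)\<bar> \<le> \<eta>" "\<And>i. i \<in> I \<Longrightarrow> \<bar>Im (a i)\<bar> \<le> \<tau>"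
    and b: "\<And>i. i \<in> I \<Longrightarrow> \<bar>1 - Re (b i)\<bar> \<le> \<eta>" "\<And>i. i \<in> I \<Longrightarrow> \<bar>Im (b i)\<bar> \<le> \<tau>"
  shows "(\<Sum>i\<in>I. a i * u i) \<noteq> 0" and "(\<Sum>i\<in>I. a i * u i) \<bullet> (\<Sum>i\<in>I. b i * u i) \<ge> 0"
proof -
  define \<theta> where "\<theta> = pi / 4 - arctan \<eta>"
  have arctan_nonneg: "0 \<le> arctan \<eta>"
    using \<eta> by simp
  have \<theta>: "0 < \<theta>" "\<theta> < pi / 2"
    unfolding \<theta>_def using arctan_less_pi_4[OF \<eta>(2)] arctan_nonneg pi_gt_zero by linarith+
  have sum_nz: "(\<Sum>i\<in>I. u i) \<noteq> 0"
  proof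
    obtain k where k: "k \<in> I"
      using I by blast
    assume "(\<Sum>i\<in>I. u i) = 0"
    then have "(\<Sum>i\<in>I. u k \<bullet> u i) = 0"
      by (simp flip: inner_sum_right)
    then have "u k \<bullet> u k = 0"
      using I k G by (subst (asm) sum_nonneg_eq_0_iff) auto
    then show False
      using u[OF k] by simp
  qed
  \<comment> \<open>Each combination is the one with real parts, turned by at most \<open>\<theta>\<close>.\<close>
  have turn: "\<exists>e. (\<Sum>i\<in>I. a i * u i) = (\<Sum>i\<in>I. Re (a i) *\<^sub>R u i) * (1 + e) \<and> norm e \<le> sin \<theta>
      \<and> (\<Sum>i\<in>I. Re (a i) *\<^sub>R u i) \<noteq> 0"
    if re: "\<And>i. i \<in> I \<Longrightarrow> \<bar>1 - Re (a i)\<bar> \<le> \<eta>" and im: "\<And>i. i \<in> I \<Longrightarrow> \<bar>Im (a i)\<bar> \<le> \<tau>"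
    for a :: "'i \<Rightarrow> complex"
  proof -
    define x where "x = (\<Sum>i\<in>I. Re (a i) *\<^sub>R u i)"
    define y where "y = (\<Sum>i\<in>I. Im (a i) *\<^sub>R u i)"
    define s where "s = (\<Sum>i\<in>I. u i)"
    have "(\<Sum>i\<in>I. a i * u i) = (\<Sum>i\<in>I. Re (a i) *\<^sub>R u i + \<i> * (Im (a i) *\<^sub>R u i))"
      by (intro sum.cong refl) (auto simp: complex_eq_iff)
    then have split: "(\<Sum>i\<in>I. a i * u i) = x + \<i> * y"
      by (simp add: x_def y_def sum.distrib sum_distrib_left)
    have "norm y \<le> norm (\<Sum>i\<in>I. \<tau> *\<^sub>R u i)"
      unfolding y_def using G im by (intro norm_comb_mono)
    also have "\<dots> = \<bar>\<tau>\<bar> * norm s"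
      by (simp add: s_def flip: scaleR_sum_right)
    also have "\<tau> \<ge> 0"
      using im I by fastforce
    then have "\<bar>\<tau>\<bar> * norm s = sin \<theta> * ((1 - \<eta>) * norm s)"
      by (simp add: \<tau> \<theta>_def)
    finally have y: "norm y \<le> sin \<theta> * ((1 - \<eta>) * norm s)" .
    have "norm (\<Sum>i\<in>I. (1 - \<eta>) *\<^sub>R u i) \<le> norm x"
      unfolding x_def using G re \<eta> by (intro norm_comb_mono) (fastforce simp: abs_le_iff)+
    then have x: "(1 - \<eta>) * norm s \<le> norm x"
      using \<eta> by (simp add: s_def flip: scaleR_sum_right)
    moreover have "0 < (1 - \<eta>) * norm s"
      using sum_nz \<eta> by (simp add: s_def)
    ultimately have x_nz: "x \<noteq> 0"
      by auto
    have "sin \<theta> \<ge> 0"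
      using \<theta> by (intro sin_ge_zero) auto
    then have "norm y \<le> sin \<theta> * norm x"
      using y mult_left_mono[OF x] by fastforce
    then have "norm (\<i> * y / x) \<le> sin \<theta>"
      using x_nz by (simp add: norm_divide norm_mult pos_divide_le_eq)
    moreover have "(\<Sum>i\<in>I. a i * u i) = x * (1 + \<i> * y / x)"
      using x_nz split by (simp add: field_simps)
    ultimately show ?thesis
      using x_nz unfolding x_def by blast
  qed
  define v w where "v = (\<Sum>i\<in>I. Re (a i) *\<^sub>R u i)" and "w = (\<Sum>i\<in>I. Re (b i) *\<^sub>R u i)"
  obtain e where e: "(\<Sum>i\<in>I. a i * u i) = v * (1 + e)" "norm e \<le> sin \<theta>" "v \<noteq> 0"
    using turn[of a] a unfolding v_def by blast
  obtain f where f: "(\<Sum>i\<in>I. b i * u i) = w * (1 + f)" "norm f \<le> sin \<theta>"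
    using turn[of b] b unfolding w_def by blast
  show "(\<Sum>i\<in>I. a i * u i) \<noteq> 0"
    using e angle_perturb(2)[OF e(2) \<theta>] by simp
  have inner_eq: "x \<bullet> y = Re (x * cnj y)" for x y :: complex
    by (simp add: inner_complex_def)
  have "(1 - \<eta>\<^sup>2) * (norm v * norm w) \<le> (1 + \<eta>\<^sup>2) * (v \<bullet> w)"
    unfolding v_def w_def using \<eta> G a(1) b(1) by (intro reverse_Cauchy_Schwarz_comb)
  moreover have "1 + \<eta>\<^sup>2 > 0"
    by (simp add: add_pos_nonneg)
  ultimately have vw: "cos (2 * arctan \<eta>) * norm (v * cnj w) \<le> Re (v * cnj w)"
    unfolding cos_double_arctan inner_eq[symmetric] by (simp add: norm_mult field_simps)
  have angles: "0 \<le> 2 * arctan \<eta>" "0 \<le> 2 * arctan \<eta> + \<theta>" "0 \<le> \<theta>" "2 * arctan \<eta> + \<theta> \<le> pi"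
    "(2 * arctan \<eta> + \<theta>) + \<theta> = pi / 2" "(2 * arctan \<eta> + \<theta>) + \<theta> \<le> pi"
    using \<theta> arctan_nonneg unfolding \<theta>_def by linarith+
  have turn_f: "cos \<theta> * norm (1 + cnj f) \<le> Re (1 + cnj f)"
    using angle_perturb(1)[of "cnj f" \<theta>] f(2) \<theta> by simp
  have "cos (2 * arctan \<eta> + \<theta>) * norm (v * cnj w * (1 + e)) \<le> Re (v * cnj w * (1 + e))"
    using vw angle_perturb(1)[OF e(2) \<theta>] angles by (intro angle_mult)
  then have "cos ((2 * arctan \<eta> + \<theta>) + \<theta>) * norm (v * cnj w * (1 + e) * (1 + cnj f))
      \<le> Re (v * cnj w * (1 + e) * (1 + cnj f))"
    using turn_f angles(2,3,6) by (rule angle_mult)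
  then have "0 \<le> Re (v * cnj w * (1 + e) * (1 + cnj f))"
    unfolding angles(5) by simp
  also have "v * cnj w * (1 + e) * (1 + cnj f) = v * (1 + e) * cnj (w * (1 + f))"
    by simp
  finally show "(\<Sum>i\<in>I. a i * u i) \<bullet> (\<Sum>i\<in>I. b i * u i) \<ge> 0"
    unfolding inner_eq e f .
qed

section \<open>Permanents of submatrices\<close>

text \<open>Extensionality makes a bijection between finite sets count only once.\<close>
definition bijections :: "'a set \<Rightarrow> 'b set \<Rightarrow> ('a \<Rightarrow> 'b) set" where
  "bijections R C = {p \<in> extensional R. bij_betw p R C}"

definition subpermanent :: "('a \<Rightarrow> 'b \<Rightarrow> 'c::comm_ring_1) \<Rightarrow> 'a set \<Rightarrow> 'b set \<Rightarrow> 'c" where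
  "subpermanent a R C = (\<Sum>p\<in>bijections R C. \<Prod>i\<in>R. a i (p i))"

lemma permanent_eq_subpermanent:
  fixes Z :: "'a::comm_ring_1 ^ 'n ^ 'n"
  shows "permanent Z = subpermanent (\<lambda>i j. Z $ i $ j) UNIV UNIV"
proof -
  have "bijections (UNIV :: 'n set) (UNIV :: 'n set) = {p. p permutes (UNIV :: 'n set)}"
    by (auto simp: bijections_def extensional_def permutes_bij intro!: bij_imp_permutes)
  then show ?thesis
    by (simp add: permanent_def subpermanent_def)
qed

lemma finite_bijections:
  assumes "finite R" "finite C"
  shows "finite (bijections R C)"
proof (rule finite_subset)
  show "bijections R C \<subseteq> R \<rightarrow>\<^sub>E C"
    by (auto simp: bijections_def PiE_def dest: bij_betwE)
  show "finite (R \<rightarrow>\<^sub>E C)"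
    using assms by (intro finite_PiE)
qed

lemma subpermanent_empty:
  fixes a :: "'a \<Rightarrow> 'b \<Rightarrow> 'c::comm_ring_1"
  shows "subpermanent a {} {} = 1"
proof -
  have "bijections ({} :: 'a set) ({} :: 'b set) = {\<lambda>_. undefined}"
    by (auto simp: bijections_def extensional_def bij_betw_def)
  then show ?thesis
    by (simp add: subpermanent_def)
qed

lemma bijections_inverse:
  assumes "p \<in> bijections R C"
  shows "restrict (inv_into R p) C \<in> bijections C R"
    and "restrict (inv_into C (restrict (inv_into R p) C)) R = p"
proof -
  have p: "bij_betw p R C" "p \<in> extensional R"
    using assms by (auto simp: bijections_def)
  have q: "bij_betw (restrict (inv_into R p) C) C R"
    using bij_betw_inv_into[OF p(1)] by (subst bij_betw_restrict_eq)
  then show "restrict (inv_into R p) C \<in> bijections C R"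
    by (simp add: bijections_def)
  have "inv_into C (restrict (inv_into R p) C) i = p i" if "i \<in> R" for i
  proof (rule inv_into_f_eq)
    show "inj_on (restrict (inv_into R p) C) C"
      using q by (simp add: bij_betw_def)
    show "p i \<in> C"
      using p that by (auto simp: bij_betw_def)
    then show "restrict (inv_into R p) C (p i) = i"
      using p that by (simp add: bij_betw_inv_into_left)
  qed
  then show "restrict (inv_into C (restrict (inv_into R p) C)) R = p"
    using p(2) by (auto simp: fun_eq_iff extensional_def)
qed

lemma subpermanent_transpose: "subpermanent a R C = subpermanent (\<lambda>j i. a i j) C R"
  unfolding subpermanent_def
proof (rule sum.reindex_bij_witness[where i = "\<lambda>q. restrict (inv_into C q) R"
      and j = "\<lambda>p. restrict (inv_into R p) C"])
  fix p assume p: "p \<in> bijections R C"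
  then have bij: "bij_betw p R C"
    by (simp add: bijections_def)
  show "(\<Prod>j\<in>C. a (restrict (inv_into R p) C j) j) = (\<Prod>i\<in>R. a i (p i))"
    using bij by (subst prod.reindex_bij_betw[OF bij, symmetric])
      (auto simp: bij_betw_inv_into_left bij_betwE intro!: prod.cong)
qed (simp_all add: bijections_inverse)

lemma subpermanent_expand_row:
  assumes fin: "finite R" "finite C" and i: "i \<notin> R"
  shows "subpermanent a (insert i R) C = (\<Sum>c\<in>C. a i c * subpermanent a R (C - {c}))"
proof -
  have "(\<Sum>c\<in>C. a i c * subpermanent a R (C - {c}))
      = (\<Sum>c\<in>C. \<Sum>q\<in>bijections R (C - {c}). a i c * (\<Prod>r\<in>R. a r (q r)))"
    by (simp add: subpermanent_def sum_distrib_left)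
  also have "\<dots> = (\<Sum>(c, q)\<in>Sigma C (\<lambda>c. bijections R (C - {c})). a i c * (\<Prod>r\<in>R. a r (q r)))"
    using fin by (intro sum.Sigma) (auto intro: finite_bijections)
  also have "\<dots> = subpermanent a (insert i R) C"
    unfolding subpermanent_def
  proof (rule sum.reindex_bij_witness[where i = "\<lambda>p. (p i, p(i := undefined))"
        and j = "\<lambda>(c, q). q(i := c)"])
    fix z assume "z \<in> Sigma C (\<lambda>c. bijections R (C - {c}))"
    then obtain c q where z: "z = (c, q)" and c: "c \<in> C"
      and q: "q \<in> extensional R" "bij_betw q R (C - {c})"
      by (auto simp: bijections_def)
    have qi: "q i = undefined"
      using q(1) i by (simp add: extensional_def)
    show "((case z of (c, q) \<Rightarrow> q(i := c)) i, (case z of (c, q) \<Rightarrow> q(i := c))(i := undefined)) = z"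
      using qi z by (auto simp: fun_eq_iff)
    have "bij_betw (q(i := c)) R (C - {c})"
      using q(2) i by (subst bij_betw_cong[of _ _ q]) auto
    then have "bij_betw (q(i := c)) (insert i R) (insert c (C - {c}))"
      using notIn_Un_bij_betw[of i R "q(i := c)" "C - {c}"] i by simp
    then show "(case z of (c, q) \<Rightarrow> q(i := c)) \<in> bijections (insert i R) C"
      using z c q(1) by (auto simp: bijections_def extensional_def insert_absorb)
    have "(\<Prod>r\<in>R. a r ((q(i := c)) r)) = (\<Prod>r\<in>R. a r (q r))"
      using i by (intro prod.cong) auto
    then show "(\<Prod>r\<in>insert i R. a r ((case z of (c, q) \<Rightarrow> q(i := c)) r))
        = (case z of (c, q) \<Rightarrow> a i c * (\<Prod>r\<in>R. a r (q r)))"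
      using z fin i by simp
  next
    fix p assume "p \<in> bijections (insert i R) C"
    then have p: "p \<in> extensional (insert i R)" "bij_betw p (insert i R) C"
      by (auto simp: bijections_def)
    show "(case (p i, p(i := undefined)) of (c, q) \<Rightarrow> q(i := c)) = p"
      by simp
    have "bij_betw p R (C - {p i})"
      using p(2) i by (auto simp: bij_betw_def inj_on_def)
    then have "bij_betw (p(i := undefined)) R (C - {p i})"
      using i by (subst bij_betw_cong[of _ _ p]) auto
    then show "(p i, p(i := undefined)) \<in> Sigma C (\<lambda>c. bijections R (C - {c}))"
      using p by (auto simp: bijections_def extensional_def bij_betw_def)
  qed
  finally show ?thesis by simp
qed

section \<open>The induction on the size\<close>

text \<open>
  Rows and columns have the same index type because the induction passes to the transpose: the
  minors in the expansion along row \<open>i\<close> differ from one another in a column.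
\<close>
lemma subpermanents_differing_in_a_row:
  fixes a :: "'a \<Rightarrow> 'a \<Rightarrow> complex"
  assumes \<eta>: "0 \<le> \<eta>" "\<eta> < 1" and \<tau>: "\<tau> = (1 - \<eta>) * sin (pi / 4 - arctan \<eta>)"
    and "\<And>i j. \<bar>1 - Re (a i j)\<bar> \<le> \<eta>" "\<And>i j. \<bar>Im (a i j)\<bar> \<le> \<tau>"
    and "finite R" "card R = m" "finite C" "card C = Suc m" "i \<notin> R" "j \<notin> R"
  shows "subpermanent a (insert i R) C \<noteq> 0
    \<and> subpermanent a (insert i R) C \<bullet> subpermanent a (insert j R) C \<ge> 0"
  using assms(4-)
proof (induction m arbitrary: a R C i j)
  case (0 a R C i j)
  then obtain c where "C = {c}" "R = {}"
    by (auto simp: card_1_singleton_iff)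
  then show ?case
    using 0 admissible_combinations[OF \<eta> \<tau>, of C "\<lambda>_. 1" "a i" "a j"]
    by (simp add: subpermanent_expand_row subpermanent_empty inner_complex_def)
next
  case (Suc m a R C i j)
  define u where "u = (\<lambda>c. subpermanent a R (C - {c}))"
  have nz: "u c \<noteq> 0" if "c \<in> C" for c
  proof -
    obtain r R' where "R = insert r R'" "r \<notin> R'" "card R' = m" "finite R'"
      using Suc.prems(3,4) by (metis card_Suc_eq finite_insert)
    moreover have "finite (C - {c})" "card (C - {c}) = Suc m"
      using Suc.prems that by auto
    ultimately show ?thesis
      unfolding u_def using Suc.IH[of a R' "C - {c}" r r] Suc.prems(1,2) by simp
  qed
  have nonobtuse: "u c \<bullet> u d \<ge> 0" if "c \<in> C" "d \<in> C" for c d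
  proof (cases "c = d")
    case False
    define C' where "C' = C - {c, d}"
    have "C - {c} = insert d C'" "C - {d} = insert c C'"
      using that False by (auto simp: C'_def)
    moreover have "finite C'" "c \<notin> C'" "d \<notin> C'" "card C' = m"
      using Suc.prems that False by (auto simp: C'_def card_Diff_subset)
    ultimately show ?thesis
      unfolding u_def subpermanent_transpose[of a]
      using Suc.IH[of "\<lambda>j i. a i j" C' R d c] Suc.prems by simp
  qed simp
  have expand: "subpermanent a (insert k R) C = (\<Sum>c\<in>C. a k c * u c)" if "k \<notin> R" for k
    using Suc.prems that by (simp add: subpermanent_expand_row u_def)
  have "C \<noteq> {}"
    using Suc.prems by auto
  then show ?case
    using admissible_combinations[OF \<eta> \<tau> \<open>finite C\<close>, of u "a i" "a j"] nz nonobtuse Suc.prems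
    by (simp add: expand)
qed

theorem theorem1p3:
  fixes \<eta> \<tau> :: real and Z :: "complex ^ 'n ^ 'n"
  assumes "0 \<le> \<eta>" and "\<eta> < 1"
    and "\<tau> = (1 - \<eta>) * sin (pi / 4 - arctan \<eta>)"
    and "\<And>i j. \<bar>1 - Re (Z $ i $ j)\<bar> \<le> \<eta>"
    and "\<And>i j. \<bar>Im (Z $ i $ j)\<bar> \<le> \<tau>"
  shows "\<tau> > 0 \<and> permanent Z \<noteq> 0"
proof
  have "0 \<le> arctan \<eta>"
    using assms(1) by simp
  then have "sin (pi / 4 - arctan \<eta>) > 0"
    using arctan_less_pi_4[OF assms(2)] pi_gt_zero by (intro sin_gt_zero) linarith+
  then show "\<tau> > 0"
    using assms(2,3) by simp
  define R where "R = UNIV - {undefined :: 'n}"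
  have R: "insert undefined R = UNIV" "undefined \<notin> R" "card (UNIV :: 'n set) = Suc (card R)"
    by (auto simp: R_def card_Diff_singleton Suc_diff_1 finite_UNIV_card_ge_0)
  \<comment> \<open>Any row can be singled out; replacing it by itself leaves only the non-vanishing.\<close>
  show "permanent Z \<noteq> 0"
    using subpermanents_differing_in_a_row[OF assms(1-3), of "\<lambda>i j. Z $ i $ j" R "card R" UNIV
        undefined undefined] assms(4,5) R
    by (simp add: permanent_eq_subpermanent)
qed

end
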